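(* Let $m,n$ be positive integers and let $(S,T)$ be a pair of random variables on a common probability space taking values in $\{0,1,\dots,m\}\times\{0,1,\dots,n\}$. For integers $1\le k\le m$ and $1\le l\le n$ let $$B_{k,l}=\frac{\binom{m}{k}\binom{n}{l}-\overline{S}_{k,l}}{\binom{m-1}{k-1}\binom{n-1}{l-1}}$$ be Gumbel's bivariate upper bound for $P(S\ge1,T\ge1)$. Then $B_{k,l}$ is non-increasing and convex in each of $k$ and $l$ separately, that is: (1) for each $1\le l\le n$: $B_{k,l}\ge B_{k+1,l}$ for $1\le k\le m-1$, and $B_{k,l}-B_{k+1,l}\ge B_{k+1,l}-B_{k+2,l}$ for $1\le k\le m-2$; (2) for each $1\le k\le m$: $B_{k,l}\ge B_{k,l+1}$ for $1\le l\le n-1$, and $B_{k,l}-B_{k,l+1}\ge B_{k,l+1}-B_{k,l+2}$ for $1\le l\le n-2$.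
   Context: For non-negative integers $a,r$, $\binom{a}{r}$ is the usual binomial coefficient, with $\binom{a}{0}=1$ and $\binom{a}{r}=0$ if $r>a$. $E$ denotes expectation. The quantity $\overline{S}_{k,l}$ is defined by $$\overline{S}_{k,l}=\binom{m}{k}E\left[\binom{n-T}{l}\right]+\binom{n}{l}E\left[\binom{m-S}{k}\right]-E\left[\binom{m-S}{k}\binom{n-T}{l}\right].$$ *)

theory Defs
  imports "HOL-Probability.Probability"
begin

text \<open>The subtractions on type \<^typ>\<open>nat\<close> below never truncate when \<open>S \<le> m\<close>, \<open>T \<le> n\<close> on
  \<open>space M\<close> and \<open>k\<close>, \<open>l\<close>, \<open>m\<close>, \<open>n\<close> are positive.\<close>

definition Sbar ::
  "'a measure \<Rightarrow> nat \<Rightarrow> nat \<Rightarrow> ('a \<Rightarrow> nat) \<Rightarrow> ('a \<Rightarrow> nat) \<Rightarrow> nat \<Rightarrow> nat \<Rightarrow> real" where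
  "Sbar M m n S T k l =
     real (m choose k) * (\<integral>\<omega>. real ((n - T \<omega>) choose l) \<partial>M)
   + real (n choose l) * (\<integral>\<omega>. real ((m - S \<omega>) choose k) \<partial>M)
   - (\<integral>\<omega>. real ((m - S \<omega>) choose k) * real ((n - T \<omega>) choose l) \<partial>M)"

definition gumbel_bound ::
  "'a measure \<Rightarrow> nat \<Rightarrow> nat \<Rightarrow> ('a \<Rightarrow> nat) \<Rightarrow> ('a \<Rightarrow> nat) \<Rightarrow> nat \<Rightarrow> nat \<Rightarrow> real" where
  "gumbel_bound M m n S T k l =
     (real (m choose k) * real (n choose l) - Sbar M m n S T k l)
     / (real ((m - 1) choose (k - 1)) * real ((n - 1) choose (l - 1)))"

end

theory Submission
  imports Defs
begin

text \<open>The numerator of \<open>B k l\<close> is the expectation of the product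
  \<open>((m choose k) - (m - S choose k)) * ((n choose l) - (n - T choose l))\<close>, so \<open>B k l\<close> is the
  expectation of a product of two non-negative factors, one depending on \<open>k\<close> and \<open>S\<close> only and
  the other on \<open>l\<close> and \<open>T\<close> only.  Telescoping in \<open>s\<close> and trinomial revision write the first as
  \<open>\<Sum>j<s. (m - k choose j) / (m - 1 choose j)\<close>, where \<open>k\<close> occurs only in \<open>m - k choose j\<close>, which is
  non-increasing and convex in \<open>k\<close>.\<close>

definition gumbel_factor :: "nat \<Rightarrow> nat \<Rightarrow> nat \<Rightarrow> real" where
  "gumbel_factor m k s =
     (real (m choose k) - real ((m - s) choose k)) / real ((m - 1) choose (k - 1))"

text \<open>Both sides count the ordered pairs of disjoint subsets of sizes \<open>i\<close> and
  \<open>j\<close> in a set of size \<open>a\<close>; when \<open>i + j > a\<close> there are none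
  and both products vanish.\<close>

lemma choose_trinomial_swap:
  fixes a i j :: nat
  assumes "i \<le> a" "j \<le> a"
  shows "(a choose i) * ((a - i) choose j) = (a choose j) * ((a - j) choose i)"
proof (cases "i + j \<le> a")
  case True
  have "(a choose i) * ((a - i) choose j) = (a choose (i + j)) * ((i + j) choose i)"
    using choose_mult[of i "i + j" a] True by simp
  moreover have "(a choose j) * ((a - j) choose i) = (a choose (i + j)) * ((i + j) choose j)"
    using choose_mult[of j "i + j" a] True by simp
  moreover have "(i + j) choose i = (i + j) choose j"
    using binomial_symmetric[of i "i + j"] by simp
  ultimately show ?thesis by simp
qed (use assms in \<open>simp add: binomial_eq_0\<close>)

lemma gumbel_factor_eq_sum:
  assumes "1 \<le> k" "k \<le> m" "s \<le> m"
  shows "gumbel_factor m k s = (\<Sum>j<s. real ((m - k) choose j) / real ((m - 1) choose j))"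
  using assms(3)
proof (induction s)
  case 0
  then show ?case by (simp add: gumbel_factor_def)
next
  case (Suc s)
  obtain p where p: "k = Suc p" using assms(1) by (cases k) auto
  \<comment> \<open>Pascal's rule with \<open>m - s = Suc (m - Suc s)\<close> gives the increment of
    the numerator from \<open>s\<close> to \<open>Suc s\<close>.\<close>
  have "(m - s) choose k = ((m - Suc s) choose p) + ((m - Suc s) choose k)"
    using Suc.prems p by (metis Suc_diff_Suc Suc_le_eq binomial_Suc_Suc)
  then have "gumbel_factor m k (Suc s) =
      gumbel_factor m k s + real ((m - Suc s) choose p) / real ((m - 1) choose p)"
    using p by (simp add: gumbel_factor_def diff_divide_distrib add_divide_distrib)
  \<comment> \<open>The swap with \<open>a = m - 1\<close> moves \<open>k\<close> from the lower
    index to the upper one, since \<open>m - 1 - p = m - k\<close>. Both \<open>s\<close> and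
    \<open>p\<close> are at most \<open>m - 1\<close>, so the two denominators below are
    nonzero.\<close>
  moreover have "((m - 1) choose s) * ((m - Suc s) choose p) = ((m - 1) choose p) * ((m - k) choose s)"
    using choose_trinomial_swap[of s "m - 1" p] Suc.prems assms p by simp
  then have "real ((m - 1) choose s) * real ((m - Suc s) choose p) =
      real ((m - 1) choose p) * real ((m - k) choose s)"
    by (metis of_nat_mult)
  then have "real ((m - Suc s) choose p) / real ((m - 1) choose p) =
      real ((m - k) choose s) / real ((m - 1) choose s)"
    using Suc.prems assms p by (simp add: divide_simps mult_ac)
  ultimately show ?case using Suc by simp
qed

lemma gumbel_factor_nonneg:
  "1 \<le> k \<Longrightarrow> k \<le> m \<Longrightarrow> s \<le> m \<Longrightarrow> 0 \<le> gumbel_factor m k s"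
  by (simp add: gumbel_factor_eq_sum sum_nonneg)

lemma gumbel_factor_antimono:
  assumes "1 \<le> k" "Suc k \<le> m" "s \<le> m"
  shows "gumbel_factor m (Suc k) s \<le> gumbel_factor m k s"
  using assms
  by (auto simp: gumbel_factor_eq_sum intro!: sum_mono divide_right_mono binomial_right_mono)

text \<open>By Pascal's rule the successive differences in the upper index are
  \<open>a choose (j - 1)\<close> and \<open>Suc a choose (j - 1)\<close> for positive
  \<open>j\<close>, and these do not decrease.\<close>

lemma choose_convex: "2 * (Suc a choose j) \<le> (Suc (Suc a) choose j) + (a choose j)"
proof (cases j)
  case (Suc i)
  have "a choose i \<le> Suc a choose i" by (rule binomial_right_mono) simp
  then show ?thesis using Suc by simp
qed simp

text \<open>Convexity holds termwise in the sum: the denominators do not involve \<open>k\<close>,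
  and reversing the upper index from \<open>k\<close> to \<open>m - k\<close> preserves
  convexity.\<close>

lemma gumbel_factor_convex:
  assumes "1 \<le> k" "k + 2 \<le> m" "s \<le> m"
  shows "2 * gumbel_factor m (k + 1) s \<le> gumbel_factor m k s + gumbel_factor m (k + 2) s"
proof -
  have "2 * real ((m - (k + 1)) choose j) \<le> real ((m - k) choose j) + real ((m - (k + 2)) choose j)"
    for j
  proof -
    have "m - (k + 1) = Suc (m - (k + 2))" "m - k = Suc (Suc (m - (k + 2)))"
      using assms by auto
    then show ?thesis using choose_convex[of "m - (k + 2)" j] by simp
  qed
  then have "2 * real ((m - (k + 1)) choose j) / c \<le>
      real ((m - k) choose j) / c + real ((m - (k + 2)) choose j) / c" if "0 \<le> c" for j c
    using divide_right_mono[OF _ that] by (metis add_divide_distrib)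
  then show ?thesis
    using assms
    by (auto simp: gumbel_factor_eq_sum sum_distrib_left simp flip: sum.distrib intro!: sum_mono)
qed

text \<open>Finitely many values make any \<open>f\<close> and \<open>g\<close> bounded along
  \<open>S\<close> and \<open>T\<close>, and a bounded measurable function is integrable for a
  probability measure.\<close>

lemma integrable_prod_of_finite_range:
  fixes f g :: "nat \<Rightarrow> real"
  assumes "prob_space M"
    and S: "S \<in> measurable M (count_space {0..m})"
    and T: "T \<in> measurable M (count_space {0..n})"
  shows "integrable M (\<lambda>\<omega>. f (S \<omega>) * g (T \<omega>))"
proof -
  interpret prob_space M by fact
  have [measurable]: "(\<lambda>\<omega>. f (S \<omega>)) \<in> borel_measurable M" "(\<lambda>\<omega>. g (T \<omega>)) \<in> borel_measurable M"
    using measurable_compose[OF S, of f borel] measurable_compose[OF T, of g borel] by auto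
  have "norm (f (S \<omega>) * g (T \<omega>)) \<le> (\<Sum>i\<in>{0..m}. \<bar>f i\<bar>) * (\<Sum>j\<in>{0..n}. \<bar>g j\<bar>)"
    if "\<omega> \<in> space M" for \<omega>
  proof -
    have "S \<omega> \<in> {0..m}" "T \<omega> \<in> {0..n}"
      using measurable_space[OF S that] measurable_space[OF T that] by auto
    then have "\<bar>f (S \<omega>)\<bar> \<le> (\<Sum>i\<in>{0..m}. \<bar>f i\<bar>)" "\<bar>g (T \<omega>)\<bar> \<le> (\<Sum>j\<in>{0..n}. \<bar>g j\<bar>)"
      by (auto intro!: member_le_sum[where f = "\<lambda>i. \<bar>f i\<bar>"] member_le_sum[where f = "\<lambda>i. \<bar>g i\<bar>"])
    then show ?thesis by (auto simp: abs_mult intro!: mult_mono sum_nonneg)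
  qed
  then show ?thesis
    by (intro integrable_const_bound AE_I2) auto
qed

lemma gumbel_bound_eq_expectation:
  assumes "prob_space M"
    and S: "S \<in> measurable M (count_space {0..m})"
    and T: "T \<in> measurable M (count_space {0..n})"
  shows "gumbel_bound M m n S T k l =
    (\<integral>\<omega>. gumbel_factor m k (S \<omega>) * gumbel_factor n l (T \<omega>) \<partial>M)"
proof -
  interpret prob_space M by fact
  note int = integrable_prod_of_finite_range[OF assms]
  let ?a = "\<lambda>\<omega>. real ((m - S \<omega>) choose k)" and ?b = "\<lambda>\<omega>. real ((n - T \<omega>) choose l)"
  let ?A = "real (m choose k)" and ?B = "real (n choose l)"
  have ints: "integrable M ?a" "integrable M ?b" "integrable M (\<lambda>\<omega>. ?a \<omega> * ?b \<omega>)"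
    \<comment> \<open>Taking one factor constantly 1 covers the integrands in \<open>S\<close> alone
      or \<open>T\<close> alone.\<close>
    using int[of "\<lambda>s. real ((m - s) choose k)" "\<lambda>_. 1"] int[of "\<lambda>_. 1" "\<lambda>t. real ((n - t) choose l)"]
      int[of "\<lambda>s. real ((m - s) choose k)" "\<lambda>t. real ((n - t) choose l)"] by auto
  \<comment> \<open>The constant \<open>?A * ?B\<close> is its own expectation because the total
    mass is 1; the integrand then factors.\<close>
  have "?A * ?B - Sbar M m n S T k l = (\<integral>\<omega>. ?A * ?B - ?A * ?b \<omega> - ?B * ?a \<omega> + ?a \<omega> * ?b \<omega> \<partial>M)"
    unfolding Sbar_def using ints by (simp add: prob_space)
  also have "\<dots> = (\<integral>\<omega>. (?A - ?a \<omega>) * (?B - ?b \<omega>) \<partial>M)"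
    by (simp add: algebra_simps)
  finally show ?thesis
    unfolding gumbel_bound_def gumbel_factor_def by simp
qed

lemma gumbel_bound_swap:
  assumes "prob_space M"
    and "S \<in> measurable M (count_space {0..m})"
    and "T \<in> measurable M (count_space {0..n})"
  shows "gumbel_bound M m n S T k l = gumbel_bound M n m T S l k"
  using assms by (simp add: gumbel_bound_eq_expectation mult.commute)

text \<open>With \<open>l\<close> fixed, the factor in \<open>T\<close> is a non-negative weight, so
  each pointwise inequality in \<open>k\<close> survives multiplication by it and
  integration.\<close>

lemma gumbel_bound_antimono_convex:
  assumes "prob_space M"
    and S: "S \<in> measurable M (count_space {0..m})"
    and T: "T \<in> measurable M (count_space {0..n})"
    and l: "1 \<le> l" "l \<le> n" and k: "1 \<le> k"
  shows gumbel_bound_antimono: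
      "k + 1 \<le> m \<Longrightarrow> gumbel_bound M m n S T (k + 1) l \<le> gumbel_bound M m n S T k l"
    and gumbel_bound_convex:
      "k + 2 \<le> m \<Longrightarrow> 2 * gumbel_bound M m n S T (k + 1) l \<le>
        gumbel_bound M m n S T k l + gumbel_bound M m n S T (k + 2) l"
proof -
  note eq = gumbel_bound_eq_expectation[OF assms(1) S T]
  note int = integrable_prod_of_finite_range[OF assms(1) S T]
  have range: "S \<omega> \<le> m" "T \<omega> \<le> n" if "\<omega> \<in> space M" for \<omega>
    using measurable_space[OF S that] measurable_space[OF T that] by auto
  show "gumbel_bound M m n S T (k + 1) l \<le> gumbel_bound M m n S T k l" if "k + 1 \<le> m"
    unfolding eq using that k l range
    by (intro integral_mono int mult_right_mono)
      (auto intro: gumbel_factor_antimono gumbel_factor_nonneg)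
  show "2 * gumbel_bound M m n S T (k + 1) l \<le>
      gumbel_bound M m n S T k l + gumbel_bound M m n S T (k + 2) l" if "k + 2 \<le> m"
  proof -
    have "(\<integral>\<omega>. 2 * (gumbel_factor m (k + 1) (S \<omega>) * gumbel_factor n l (T \<omega>)) \<partial>M) \<le>
        (\<integral>\<omega>. gumbel_factor m k (S \<omega>) * gumbel_factor n l (T \<omega>) +
             gumbel_factor m (k + 2) (S \<omega>) * gumbel_factor n l (T \<omega>) \<partial>M)"
    proof (intro integral_mono integrable_mult_right Bochner_Integration.integrable_add int)
      fix \<omega> assume "\<omega> \<in> space M"
      then show "2 * (gumbel_factor m (k + 1) (S \<omega>) * gumbel_factor n l (T \<omega>)) \<le>
          gumbel_factor m k (S \<omega>) * gumbel_factor n l (T \<omega>) +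
          gumbel_factor m (k + 2) (S \<omega>) * gumbel_factor n l (T \<omega>)"
        using mult_right_mono[OF gumbel_factor_convex[of k m "S \<omega>"] gumbel_factor_nonneg[of l n "T \<omega>"]]
          range that k l by (simp add: distrib_right mult.assoc)
    qed
    then show ?thesis
      unfolding eq by (simp add: int)
  qed
qed

theorem mainTheorem6:
  fixes M :: "'a measure" and m n :: nat and S T :: "'a \<Rightarrow> nat"
  defines "B \<equiv> gumbel_bound M m n S T"
  assumes "prob_space M"
    and "m \<ge> 1" and "n \<ge> 1"
    and "S \<in> measurable M (count_space {0..m})"
    and "T \<in> measurable M (count_space {0..n})"
  shows "(\<forall>l\<in>{1..n}.
            (\<forall>k\<in>{1..m - 1}. B k l \<ge> B (k + 1) l) \<and>
            (\<forall>k\<in>{1..m - 2}. B k l - B (k + 1) l \<ge> B (k + 1) l - B (k + 2) l)) \<and>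
         (\<forall>k\<in>{1..m}.
            (\<forall>l\<in>{1..n - 1}. B k l \<ge> B k (l + 1)) \<and>
            (\<forall>l\<in>{1..n - 2}. B k l - B k (l + 1) \<ge> B k (l + 1) - B k (l + 2)))"
proof -
  note MST = assms(2,5,6)
  note MTS = assms(2,6,5)
  note swap = gumbel_bound_swap[OF MST]
  have "B (k + 1) l \<le> B k l" if "l \<in> {1..n}" "k \<in> {1..m - 1}" for k l
    unfolding B_def using gumbel_bound_antimono[OF MST, of l k] that by auto
  moreover have "B (k + 1) l - B (k + 2) l \<le> B k l - B (k + 1) l"
    if "l \<in> {1..n}" "k \<in> {1..m - 2}" for k l
    proof -
    \<comment> \<open>Since \<open>1 \<le> k \<le> m - 2\<close>, the subtraction cannot have
      truncated, so \<open>k + 2 \<le> m\<close> follows.\<close>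
    have "1 \<le> k" "k + 2 \<le> m" using that by auto
    then show ?thesis
      unfolding B_def using gumbel_bound_convex[OF MST, of l k] that by simp
  qed
  \<comment> \<open>The claims in \<open>l\<close> are the claims in \<open>k\<close> with the pairs
    \<open>(m, S)\<close> and \<open>(n, T)\<close> exchanged.\<close>
  moreover have "B k (l + 1) \<le> B k l" if "k \<in> {1..m}" "l \<in> {1..n - 1}" for k l
    unfolding B_def swap using gumbel_bound_antimono[OF MTS, of k l] that by auto
  moreover have "B k (l + 1) - B k (l + 2) \<le> B k l - B k (l + 1)"
    if "k \<in> {1..m}" "l \<in> {1..n - 2}" for k l
    proof -
    have "1 \<le> l" "l + 2 \<le> n" using that by auto
    then show ?thesis
      unfolding B_def swap using gumbel_bound_convex[OF MTS, of k l] that by simp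
  qed
  ultimately show ?thesis by blast
qed

end
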